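(* Let $\lambda/\mu$ be a skew shape with $\lambda_1=\lambda_2$ such that $\mathbb{D}(\lambda/\mu)$ is a ribbon, let $s=\mu_1$, and let $C_0,C_1,\ldots,C_s$ be the associated excitation coefficients. Then \[ \frac{C_0}{0!}\geq\frac{C_1}{1!}\geq\frac{C_2}{2!}\geq\cdots\geq\frac{C_s}{s!}. \]
   Context: A partition $\lambda=(\lambda_1\ge\lambda_2\ge\cdots)$ is a weakly decreasing sequence of nonnegative integers that is eventually $0$. Its Young diagram $\mathbb{D}(\lambda)$ is the left-justified array of cells $c_{i,j}$ ($i$-th row from the top, $j$-th column), $1\le j\le\lambda_i$. For $\mu\subseteq\lambda$, the skew diagram $\mathbb{D}(\lambda/\mu)$ consists of the cells of $\mathbb{D}(\lambda)$ not in $\mathbb{D}(\mu)$; it is connected if $\mu_i<\lambda_{i+1}$ whenever $\mu_i\ne 0$. A ribbon is a nonempty connected skew diagram containing no $2\times 2$ block of cells. The hook length $h(c)=h(c;\lambda)$ of $c\in\mathbb{D}(\lambda)$ is the number of cells of $\mathbb{D}(\lambda)$ in the same row weakly to the right of $c$ or in the same column strictly below $c$. For $k\in\mathbb{Z}$, $X_k=\{c_{i,j}\in\mathbb{D}(\lambda): j-i=k\}$. Cells are partially ordered by $c_{i,j}\le c_{i',j'}$ iff $i\le i'$ and $j\le j'$. An excited diagram of type $\lambda/\mu$ is a subset $D$ of cells of $\mathbb{D}(\lambda)$ for which there is a bijection $\eta:\mathbb{D}(\mu)\to D$ with $\eta(c_{i,j})\in X_{j-i}$ for all $c_{i,j}\in\mathbb{D}(\mu)$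 and such that for each $k\in\mathbb{Z}$ the restriction of $\eta$ to $\mathbb{D}(\mu)\cap(X_k\cup X_{k+1})$ is order-preserving. $\mathbb{E}(\lambda/\mu)$ is the set of excited diagrams of type $\lambda/\mu$. For $D\in\mathbb{E}(\lambda/\mu)$ let $\overline{D}$ be $D$ with all cells in the first row removed. For $0\le d\le s=\mu_1$ the excitation coefficients are defined by \[ C_{s-d}=\sum_{\substack{D\in\mathbb{E}(\lambda/\mu)\\ \#(D\setminus\overline{D})=d}}\ \prod_{c\in\overline{D}}h(c;\lambda). \] *)

theory Defs
  imports Complex_Main "HOL-Library.Product_Order"
begin

text \<open>
  A partition is a function on indices \<open>i \<ge> 1\<close>; the value at index \<open>0\<close> is junk and is never used.
  A cell is a pair \<open>(i, j)\<close> of its row and column, both counted from \<open>1\<close>.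
\<close>

definition is_partition :: "(nat \<Rightarrow> nat) \<Rightarrow> bool" where
  "is_partition lam \<longleftrightarrow>
     (\<forall>i\<ge>1. lam (Suc i) \<le> lam i) \<and> (\<exists>N. \<forall>i\<ge>N. lam i = 0)"

definition diagram :: "(nat \<Rightarrow> nat) \<Rightarrow> (nat \<times> nat) set" where
  "diagram lam = {(i, j). 1 \<le> i \<and> 1 \<le> j \<and> j \<le> lam i}"

definition skew_shape :: "(nat \<Rightarrow> nat) \<Rightarrow> (nat \<Rightarrow> nat) \<Rightarrow> bool" where
  "skew_shape lam mu \<longleftrightarrow>
     is_partition lam \<and> is_partition mu \<and> (\<forall>i\<ge>1. mu i \<le> lam i)"

definition skew_diagram :: "(nat \<Rightarrow> nat) \<Rightarrow> (nat \<Rightarrow> nat) \<Rightarrow> (nat \<times> nat) set" where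
  "skew_diagram lam mu = diagram lam - diagram mu"

definition skew_connected :: "(nat \<Rightarrow> nat) \<Rightarrow> (nat \<Rightarrow> nat) \<Rightarrow> bool" where
  "skew_connected lam mu \<longleftrightarrow> (\<forall>i\<ge>1. mu i \<noteq> 0 \<longrightarrow> mu i < lam (Suc i))"

definition ribbon :: "(nat \<Rightarrow> nat) \<Rightarrow> (nat \<Rightarrow> nat) \<Rightarrow> bool" where
  "ribbon lam mu \<longleftrightarrow>
     skew_diagram lam mu \<noteq> {} \<and> skew_connected lam mu \<and>
     \<not> (\<exists>i j. {(i, j), (i, Suc j), (Suc i, j), (Suc i, Suc j)} \<subseteq> skew_diagram lam mu)"

definition hook_length :: "(nat \<Rightarrow> nat) \<Rightarrow> nat \<times> nat \<Rightarrow> nat" where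
  "hook_length lam = (\<lambda>(i, j).
     card {(i', j') \<in> diagram lam. (i' = i \<and> j \<le> j') \<or> (j' = j \<and> i < i')})"

definition content_diagonal :: "(nat \<Rightarrow> nat) \<Rightarrow> int \<Rightarrow> (nat \<times> nat) set" where
  "content_diagonal lam k = {(i, j) \<in> diagram lam. int j - int i = k}"

text \<open>
  The order on cells is the componentwise order on pairs of \<^theory>\<open>HOL-Library.Product_Order\<close>,
  and it is the one to which \<^const>\<open>mono_on\<close> refers below.
\<close>

definition excited_diagrams :: "(nat \<Rightarrow> nat) \<Rightarrow> (nat \<Rightarrow> nat) \<Rightarrow> (nat \<times> nat) set set" where
  "excited_diagrams lam mu = {D. D \<subseteq> diagram lam \<and>
     (\<exists>\<eta>. bij_betw \<eta> (diagram mu) D \<and>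
          (\<forall>(i, j) \<in> diagram mu. \<eta> (i, j) \<in> content_diagonal lam (int j - int i)) \<and>
          (\<forall>k. mono_on (diagram mu \<inter> (content_diagonal lam k \<union> content_diagonal lam (k + 1))) \<eta>))}"

definition remove_first_row :: "(nat \<times> nat) set \<Rightarrow> (nat \<times> nat) set" where
  "remove_first_row D = {(i, j) \<in> D. i \<noteq> 1}"

text \<open>
  The index \<open>k\<close> stands for \<open>s - d\<close>, where \<open>s = mu 1\<close> and \<open>d\<close> is the number of cells in the first
  row; writing \<open>d + k = s\<close> avoids truncated subtraction. It is meant for \<open>k \<le> s\<close>.
\<close>

definition excitation_coeff :: "(nat \<Rightarrow> nat) \<Rightarrow> (nat \<Rightarrow> nat) \<Rightarrow> nat \<Rightarrow> nat" where
  "excitation_coeff lam mu k =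
     (\<Sum>D | D \<in> excited_diagrams lam mu \<and> card (D - remove_first_row D) + k = mu 1.
        \<Prod>c\<in>remove_first_row D. hook_length lam c)"

end

theory Submission
  imports Defs
begin

text \<open>
  If \<open>\<lambda>/\<mu>\<close> is a ribbon, it is the whole outer rim of \<open>\<lambda>\<close>: \<open>\<mu>\<close> is \<open>\<lambda>\<close> without its first row and first
  column, that is, \<open>\<mu>\<^sub>i = \<lambda>\<^sub>i\<^sub>+\<^sub>1 - 1\<close> (\<open>ribbon_inner_shape\<close>). Each diagonal then has only one more cell
  in \<open>\<lambda>\<close> than in \<open>\<mu>\<close>, so an excited diagram moves every cell of \<open>\<mu>\<close> by at most one step along its
  diagonal. By monotonicity the cells that stay form the diagram of a partition \<open>\<kappa> \<subseteq> \<mu>\<close>, and every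
  such \<open>\<kappa>\<close> occurs for exactly one excited diagram (\<open>excited_diagrams_eq\<close>, \<open>inj_on_excite_image\<close>).
  The cells of \<open>\<lambda>\<close> that this diagram misses are \<open>(i, \<kappa>\<^sub>i + 1), \<dots>, (i, \<kappa>\<^sub>i\<^sub>-\<^sub>1 + 1)\<close> in row \<open>i > 1\<close>;
  they form a lattice path that enters the first row in column \<open>\<kappa>\<^sub>1 + 1\<close>.

  Let \<open>S\<^sub>r(d)\<close> be the sum, over the parts of these paths in the rows below \<open>r\<close> that leave row
  \<open>r + 1\<close> upwards in column \<open>d + 1\<close>, of the product of the hook lengths of the cells off the path.
  Then \<open>C\<^sub>k = S\<^sub>1(s - k)\<close>. Looking at how the path reaches its last cell \<open>(r + 1, d + 1)\<close>, from the
  left or from below, gives \<open>h(r+1,d+1) S\<^sub>r(d) = S\<^sub>r(d - 1) + P\<^sub>r S\<^sub>r\<^sub>+\<^sub>1(d)\<close>,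
  where \<open>P\<^sub>r\<close> is the product of all hook lengths in row \<open>r + 1\<close> and terms of impossible paths are \<open>0\<close>
  (\<open>hook_times_tail_sum\<close>).

  The theorem is the case \<open>r = 1\<close> of \<open>S\<^sub>r(d - 1) \<le> (\<lambda>\<^sub>r\<^sub>+\<^sub>1 - d) S\<^sub>r(d)\<close> (\<open>tail_sum_le\<close>): there
  \<open>d = s - k\<close> and \<open>\<lambda>\<^sub>2 = s + 1\<close> give \<open>C\<^sub>k\<^sub>+\<^sub>1 \<le> (k + 1) C\<^sub>k\<close>. The factor
  \<open>\<lambda>\<^sub>r\<^sub>+\<^sub>1 - d\<close> is the hook length \<open>h(r+1,d+1)\<close> without the leg, so by the recursion the claim says
  that \<open>leg(r+1,d+1) S\<^sub>r(d - 1) \<le> (\<lambda>\<^sub>r\<^sub>+\<^sub>1 - d) P\<^sub>r S\<^sub>r\<^sub>+\<^sub>1(d)\<close>. This is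
  trivial for an empty leg; otherwise apply the recursion once more, to
  \<open>h(r+1,d) S\<^sub>r(d - 1)\<close>, and bound its two terms by the claim for \<open>(r, d - 1)\<close> and for \<open>(r + 1, d)\<close>.
  The first bound cancels the part of \<open>h(r+1,d)\<close> outside the leg and leaves
  \<open>leg(r+1,d) S\<^sub>r(d - 1) \<le> (\<lambda>\<^sub>r\<^sub>+\<^sub>2 - d) P\<^sub>r S\<^sub>r\<^sub>+\<^sub>1(d)\<close>, which suffices because legs shrink to the right
  and rows shrink downwards.
\<close>

section \<open>Shapes whose skew diagram is the outer rim\<close>

lemma mem_remove_first_row: "x \<in> remove_first_row D \<longleftrightarrow> x \<in> D \<and> fst x \<noteq> 1"
  by (cases x) (simp add: remove_first_row_def)

lemma is_partition_antimono:
  assumes "is_partition lam" "1 \<le> i" "i \<le> i'"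
  shows "lam i' \<le> lam i"
  using assms(3)
proof (induction i' rule: dec_induct)
  case (step n)
  then show ?case
    using assms(1,2) by (meson is_partition_def le_trans)
qed simp

text \<open>
  The parameter \<open>N\<close> bounds the number of rows, which makes products over all rows finite and gives
  inductions from the bottom row upwards a place to start.
\<close>

locale border_strip =
  fixes lam mu :: "nat \<Rightarrow> nat" and N :: nat
  assumes partition: "is_partition lam"
    and mu_eq: "1 \<le> i \<Longrightarrow> mu i = lam (Suc i) - 1"
    and lam_eq_0: "N < i \<Longrightarrow> lam i = 0"
begin

lemma antimono: "1 \<le> i \<Longrightarrow> i \<le> i' \<Longrightarrow> lam i' \<le> lam i"
  using partition by (rule is_partition_antimono)

lemma mem_mu_iff:
  "(i, j) \<in> diagram mu \<longleftrightarrow> 1 \<le> i \<and> 1 \<le> j \<and> (Suc i, Suc j) \<in> diagram lam"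
  using mu_eq[of i] by (auto simp: diagram_def)

lemma diagram_lam_down_closed:
  assumes "(i', j') \<in> diagram lam" "1 \<le> i" "1 \<le> j" "i \<le> i'" "j \<le> j'"
  shows "(i, j) \<in> diagram lam"
  using assms antimono[of i i'] by (auto simp: diagram_def)

lemma diagram_mu_down_closed:
  assumes "(i', j') \<in> diagram mu" "1 \<le> i" "1 \<le> j" "i \<le> i'" "j \<le> j'"
  shows "(i, j) \<in> diagram mu"
  using assms diagram_lam_down_closed[of "Suc i'" "Suc j'" "Suc i" "Suc j"]
  by (auto simp: mem_mu_iff)

lemma diagram_mu_subset: "diagram mu \<subseteq> diagram lam"
  using diagram_lam_down_closed by (force simp: mem_mu_iff)

lemma row_less: "(i, j) \<in> diagram mu \<Longrightarrow> i < N"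
  using lam_eq_0[of "Suc i"] mu_eq[of i] by (cases "i < N") (auto simp: diagram_def)

section \<open>Hook lengths\<close>

definition leg :: "nat \<Rightarrow> nat \<Rightarrow> nat" where
  "leg i j = card {i'. i < i' \<and> j \<le> lam i'}"

lemma finite_leg: "1 \<le> j \<Longrightarrow> finite {i'. i < i' \<and> j \<le> lam i'}"
  by (rule finite_subset[of _ "{..N}"]) (use lam_eq_0 in \<open>fastforce simp: not_less[symmetric]\<close>)+

lemma leg_antimono: "1 \<le> j \<Longrightarrow> j \<le> j' \<Longrightarrow> leg i j' \<le> leg i j"
  unfolding leg_def by (rule card_mono) (auto simp: finite_leg)

lemma leg_eq_0:
  assumes "lam (Suc i) < j"
  shows "leg i j = 0"
proof -
  have "{i'. i < i' \<and> j \<le> lam i'} = {}"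
    using assms antimono[of "Suc i"] by (auto simp: Suc_le_eq not_le intro: le_less_trans)
  then show ?thesis by (simp only: leg_def card.empty)
qed

lemma hook_length_eq:
  assumes "1 \<le> i" "j < lam i"
  shows "hook_length lam (i, Suc j) = lam i - j + leg i (Suc j)"
proof -
  have "{(i', j') \<in> diagram lam. (i' = i \<and> Suc j \<le> j') \<or> (j' = Suc j \<and> i < i')}
      = {i} \<times> {Suc j..lam i} \<union> {i'. i < i' \<and> Suc j \<le> lam i'} \<times> {Suc j}"
    using assms by (auto simp: diagram_def)
  moreover have "card ({i} \<times> {Suc j..lam i} \<union> {i'. i < i' \<and> Suc j \<le> lam i'} \<times> {Suc j})
      = lam i - j + leg i (Suc j)"
    by (subst card_Un_disjoint) (auto simp: finite_leg leg_def card_cartesian_product)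
  ultimately show ?thesis by (simp add: hook_length_def)
qed

section \<open>Excited diagrams as subpartitions\<close>

text \<open>
  The excitation that fixes the cells of \<open>kap\<close> and moves every other cell one step down its diagonal.
\<close>

definition excite :: "(nat \<Rightarrow> nat) \<Rightarrow> nat \<times> nat \<Rightarrow> nat \<times> nat" where
  "excite kap = (\<lambda>(i, j). if j \<le> kap i then (i, j) else (Suc i, Suc j))"

text \<open>
  The condition at the meaningless index \<open>0\<close> makes a partition determined by its diagram, as is
  needed for counting.
\<close>

definition subpartitions :: "(nat \<Rightarrow> nat) set" where
  "subpartitions = {kap. kap 0 = 0 \<and> (\<forall>i\<ge>1. kap (Suc i) \<le> kap i \<and> kap i \<le> mu i)}"

lemma subpartition_antimono:
  assumes "kap \<in> subpartitions" "1 \<le> i" "i \<le> i'"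
  shows "kap i' \<le> kap i"
  using assms(3)
proof (induction i' rule: dec_induct)
  case (step n)
  then show ?case
    using assms(1,2) by (auto simp: subpartitions_def intro: le_trans)
qed simp

lemma excite_image_excited:
  assumes "kap \<in> subpartitions"
  shows "excite kap ` diagram mu \<in> excited_diagrams lam mu"
proof -
  have anti: "kap i' \<le> kap i" if "1 \<le> i" "i \<le> i'" for i i'
    using subpartition_antimono[OF assms that] .
  have "inj_on (excite kap) (diagram mu)"
  proof (rule inj_onI, clarify)
    fix i j i' j'
    assume "(i, j) \<in> diagram mu" "(i', j') \<in> diagram mu" "excite kap (i, j) = excite kap (i', j')"
    then show "i = i' \<and> j = j'"
      using anti[of i "Suc i"] anti[of i' "Suc i'"]
      by (auto simp: excite_def diagram_def split: if_splits)
  qed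
  moreover have in_lam: "excite kap x \<in> diagram lam" if "x \<in> diagram mu" for x
    using that diagram_mu_subset by (auto simp: excite_def mem_mu_iff split: prod.splits)
  moreover have "excite kap (i, j) \<in> content_diagonal lam (int j - int i)"
    if "(i, j) \<in> diagram mu" for i j
    using in_lam[OF that] by (auto simp: content_diagonal_def excite_def)
  moreover have "mono_on (diagram mu) (excite kap)"
  proof (rule mono_onI)
    fix x y assume "x \<in> diagram mu" "y \<in> diagram mu" "x \<le> y"
    then show "excite kap x \<le> excite kap y"
      using anti[of "fst x" "fst y"]
      by (auto simp: excite_def less_eq_prod_def diagram_def split: prod.splits)
  qed
  then have "mono_on (diagram mu \<inter> A) (excite kap)" for A
    by (rule mono_on_subset) auto
  ultimately show ?thesis
    unfolding excited_diagrams_def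
    by (intro CollectI conjI exI[of _ "excite kap"]) (auto simp: bij_betw_def)
qed

text \<open>
  A cell \<open>x\<close> fixed for \<open>kap\<close> but moved for \<open>kap'\<close> can lie in the second image only as the shift of
  its upper left diagonal neighbour. That neighbour lies in \<open>kap\<close> because \<open>x\<close> does, but not in \<open>kap'\<close>
  because it was moved, so the same conflict occurs one row higher; it cannot climb forever.
\<close>

lemma subpartition_le_of_image_subset:
  assumes kap: "kap \<in> subpartitions" and kap': "kap' \<in> subpartitions"
    and sub: "excite kap ` diagram mu \<subseteq> excite kap' ` diagram mu"
    and "1 \<le> i" "1 \<le> j" "j \<le> kap i"
  shows "j \<le> kap' i"
  using assms(4-6)
proof (induction i arbitrary: j)
  case (Suc i)
  have "(Suc i, j) \<in> diagram mu" "excite kap (Suc i, j) = (Suc i, j)"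
    using Suc.prems kap by (auto simp: diagram_def subpartitions_def excite_def intro: le_trans)
  then have "(Suc i, j) \<in> excite kap' ` diagram mu"
    using sub by (metis imageI subsetD)
  then obtain a b where ab: "(a, b) \<in> diagram mu" "(Suc i, j) = excite kap' (a, b)"
    by auto
  show ?case
  proof (rule ccontr)
    assume "\<not> j \<le> kap' (Suc i)"
    with ab have "a = i" "j = Suc b" "\<not> b \<le> kap' i" "1 \<le> i" "1 \<le> b"
      by (auto simp: excite_def diagram_def split: if_splits)
    moreover have "b \<le> kap i"
      using subpartition_antimono[OF kap, of i "Suc i"] Suc.prems calculation by simp
    ultimately show False
      using Suc.IH by blast
  qed
qed simp

lemma inj_on_excite_image: "inj_on (\<lambda>kap. excite kap ` diagram mu) subpartitions"
proof (rule inj_onI)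
  fix kap kap'
  assume *: "kap \<in> subpartitions" "kap' \<in> subpartitions"
    "excite kap ` diagram mu = excite kap' ` diagram mu"
  show "kap = kap'"
  proof
    fix i :: nat
    consider "i = 0" | "1 \<le> i" by linarith
    then show "kap i = kap' i"
    proof cases
      case 1
      with * show ?thesis by (simp add: subpartitions_def)
    next
      case 2
      have "kap i \<le> kap' i"
        using subpartition_le_of_image_subset[of kap kap' i "kap i"] * 2 by (cases "kap i") auto
      moreover have "kap' i \<le> kap i"
        using subpartition_le_of_image_subset[of kap' kap i "kap' i"] * 2 by (cases "kap' i") auto
      ultimately show ?thesis by simp
    qed
  qed
qed

text \<open>
  Along a diagonal the images of consecutive cells strictly descend. Counted from the start of the
  diagonal, this prevents a cell from moving up. Counted from its end, it prevents a cell from moving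
  down by two or more: this would push its successor equally far, and since the diagonal has only one
  cell beyond \<open>mu\<close>, there would always be a further successor.
\<close>

lemma excited_bijection_moves:
  assumes inj: "inj_on \<eta> (diagram mu)"
    and content: "\<forall>(i, j) \<in> diagram mu. \<eta> (i, j) \<in> content_diagonal lam (int j - int i)"
    and mono: "\<forall>k. mono_on (diagram mu \<inter> (content_diagonal lam k \<union> content_diagonal lam (k + 1))) \<eta>"
    and x: "(i, j) \<in> diagram mu"
  shows "\<eta> (i, j) = (i, j) \<or> \<eta> (i, j) = (Suc i, Suc j)"
proof -
  have \<eta>_lam: "\<eta> (i, j) \<in> diagram lam \<and> int (snd (\<eta> (i, j))) - int (fst (\<eta> (i, j))) = int j - int i"
    if "(i, j) \<in> diagram mu" for i j
    using content that by (fastforce simp: content_diagonal_def)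
  have diag: "fst (\<eta> (i, j)) < fst (\<eta> (Suc i, Suc j))"
    if "(i, j) \<in> diagram mu" "(Suc i, Suc j) \<in> diagram mu" for i j
  proof -
    have "\<eta> (i, j) \<le> \<eta> (Suc i, Suc j)"
      by (rule mono_onD[OF mono[rule_format, of "int j - int i"]])
        (use that diagram_mu_subset in \<open>auto simp: content_diagonal_def\<close>)
    moreover have "\<eta> (i, j) \<noteq> \<eta> (Suc i, Suc j)"
      using inj_onD[OF inj _ that] by auto
    ultimately show ?thesis
      using \<eta>_lam[OF that(1)] \<eta>_lam[OF that(2)] by (auto simp: less_eq_prod_def prod_eq_iff)
  qed
  have lower: "i \<le> fst (\<eta> (i, j))" if "(i, j) \<in> diagram mu" for i j
    using that
  proof (induction i arbitrary: j)
    case (Suc i)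
    show ?case
    proof (cases "i = 0 \<or> j \<le> 1")
      case True
      then show ?thesis
        using \<eta>_lam[OF Suc.prems] Suc.prems by (auto simp: diagram_def)
    next
      case False
      then obtain j' where j': "j = Suc j'" "1 \<le> j'"
        by (cases j) auto
      then have "(i, j') \<in> diagram mu"
        using Suc.prems False by (auto intro: diagram_mu_down_closed)
      then show ?thesis
        using Suc.IH diag[of i j'] Suc.prems j' by fastforce
    qed
  qed simp
  have upper: "fst (\<eta> (i, j)) \<le> Suc i"
  proof (rule ccontr)
    assume far: "\<not> fst (\<eta> (i, j)) \<le> Suc i"
    \<comment> \<open>The excess of two rows propagates to all successors on the diagonal.\<close>
    have "(i + n, j + n) \<in> diagram mu \<and> Suc (i + n) < fst (\<eta> (i + n, j + n))" for n
    proof (induction n)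
      case 0
      with x far show ?case by simp
    next
      case (Suc n)
      let ?a = "i + n" and ?b = "j + n"
      obtain p q where pq: "\<eta> (?a, ?b) = (p, q)" by fastforce
      have "(p, q) \<in> diagram lam" "Suc (Suc ?a) \<le> p" "Suc (Suc ?b) \<le> q"
        using \<eta>_lam[of ?a ?b] Suc pq by auto
      then have "(Suc (Suc ?a), Suc (Suc ?b)) \<in> diagram lam"
        using diagram_lam_down_closed by simp
      then have "(Suc ?a, Suc ?b) \<in> diagram mu"
        by (simp add: mem_mu_iff)
      with diag[of ?a ?b] Suc show ?case by auto
    qed
    from this[of N] show False
      using row_less by fastforce
  qed
  show ?thesis
    using \<eta>_lam[OF x] lower[OF x] upper by (auto simp: prod_eq_iff)
qed

text \<open>
  The fixed cells are closed under going left and up: a left or upper neighbour of a fixed cell lies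
  on an adjacent diagonal, so its image is bounded by that cell, which rules out the shift. Hence
  they form a diagram.
\<close>

lemma excited_is_excite_image:
  assumes "D \<in> excited_diagrams lam mu"
  shows "D \<in> (\<lambda>kap. excite kap ` diagram mu) ` subpartitions"
proof -
  obtain \<eta> where bij: "bij_betw \<eta> (diagram mu) D"
    and content: "\<forall>(i, j) \<in> diagram mu. \<eta> (i, j) \<in> content_diagonal lam (int j - int i)"
    and mono: "\<forall>k. mono_on (diagram mu \<inter> (content_diagonal lam k \<union> content_diagonal lam (k + 1))) \<eta>"
    using assms by (auto simp: excited_diagrams_def)
  have moves: "\<eta> (i, j) = (i, j) \<or> \<eta> (i, j) = (Suc i, Suc j)" if "(i, j) \<in> diagram mu" for i j
    using excited_bijection_moves[OF _ content mono that] bij by (simp add: bij_betw_def)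
  have left: "\<eta> (i, j) = (i, j)" if "(i, Suc j) \<in> diagram mu" "1 \<le> j" "\<eta> (i, Suc j) = (i, Suc j)" for i j
  proof -
    have mu: "(i, j) \<in> diagram mu"
      by (rule diagram_mu_down_closed[OF that(1)]) (use that in \<open>auto simp: diagram_def\<close>)
    have "\<eta> (i, j) \<le> \<eta> (i, Suc j)"
      by (rule mono_onD[OF mono[rule_format, of "int j - int i"]])
        (use that mu diagram_mu_subset in \<open>auto simp: content_diagonal_def\<close>)
    with moves[OF mu] that show ?thesis by auto
  qed
  have up: "\<eta> (i, j) = (i, j)" if "(Suc i, j) \<in> diagram mu" "1 \<le> i" "\<eta> (Suc i, j) = (Suc i, j)" for i j
  proof -
    have mu: "(i, j) \<in> diagram mu"
      by (rule diagram_mu_down_closed[OF that(1)]) (use that in \<open>auto simp: diagram_def\<close>)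
    have "\<eta> (i, j) \<le> \<eta> (Suc i, j)"
      by (rule mono_onD[OF mono[rule_format, of "int j - int (Suc i)"]])
        (use that mu diagram_mu_subset in \<open>auto simp: content_diagonal_def\<close>)
    with moves[OF mu] that show ?thesis by auto
  qed
  define fixed where "fixed i j \<longleftrightarrow> (i, j) \<in> diagram mu \<and> \<eta> (i, j) = (i, j)" for i j
  define kap where "kap i = card {j. fixed i j}" for i
  have fixed_iff: "fixed i j \<longleftrightarrow> 1 \<le> j \<and> j \<le> kap i" for i j
  proof -
    have fin: "finite {j. fixed i j}"
      by (rule finite_subset[of _ "{..mu i}"]) (auto simp: fixed_def diagram_def)
    have down: "fixed i a" if "fixed i b" "1 \<le> a" "a \<le> b" for a b
      using that(3,1)
    proof (induction a rule: inc_induct)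
      case (step n)
      then show ?case
        using left[of i n] that(2) 
        by (auto simp: fixed_def intro: diagram_mu_down_closed simp: diagram_def)
    qed
    show ?thesis
    proof
      assume "fixed i j"
      then have "{1..j} \<subseteq> {j. fixed i j}"
        using down by auto
      then have "card {1..j} \<le> kap i"
        unfolding kap_def by (rule card_mono[OF fin])
      then show "1 \<le> j \<and> j \<le> kap i"
        using \<open>fixed i j\<close> by (auto simp: fixed_def diagram_def)
    next
      assume j: "1 \<le> j \<and> j \<le> kap i"
      show "fixed i j"
      proof (rule ccontr)
        assume "\<not> fixed i j"
        then have "{j. fixed i j} \<subseteq> {1..<j}"
          using down[of _ j] j by (force simp: fixed_def diagram_def not_less[symmetric])
        then have "kap i \<le> card {1..<j}"
          unfolding kap_def by (rule card_mono[rotated]) simp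
        then have "kap i \<le> j - 1" by simp
        with j show False by linarith
      qed
    qed
  qed
  have "kap (Suc i) \<le> kap i \<and> kap i \<le> mu i" if "1 \<le> i" for i
  proof
    show "kap (Suc i) \<le> kap i"
    proof (cases "kap (Suc i) = 0")
      case False
      then have "fixed (Suc i) (kap (Suc i))"
        by (simp add: fixed_iff)
      then have "fixed i (kap (Suc i))"
        using up[of i] that diagram_mu_down_closed[of "Suc i" "kap (Suc i)" i]
        by (simp add: fixed_def diagram_def)
      then show ?thesis by (simp add: fixed_iff)
    qed simp
    show "kap i \<le> mu i"
    proof (cases "kap i = 0")
      case False
      then have "fixed i (kap i)"
        by (simp add: fixed_iff)
      then show ?thesis by (simp add: fixed_def diagram_def)
    qed simp
  qed
  moreover have "kap 0 = 0"
    by (simp add: kap_def fixed_def diagram_def)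
  ultimately have "kap \<in> subpartitions"
    by (simp add: subpartitions_def)
  moreover have "\<eta> (i, j) = excite kap (i, j)" if "(i, j) \<in> diagram mu" for i j
  proof -
    have "j \<le> kap i \<longleftrightarrow> \<eta> (i, j) = (i, j)"
      using fixed_iff[of i j] that by (simp add: fixed_def diagram_def)
    with moves[OF that] show ?thesis
      by (auto simp: excite_def)
  qed
  then have "\<eta> ` diagram mu = excite kap ` diagram mu"
    by (intro image_cong) auto
  then have "D = excite kap ` diagram mu"
    using bij by (simp add: bij_betw_def)
  ultimately show ?thesis by blast
qed

lemma excited_diagrams_eq:
  "excited_diagrams lam mu = (\<lambda>kap. excite kap ` diagram mu) ` subpartitions"
  using excite_image_excited excited_is_excite_image by blast

section \<open>Row by row expansion of the excitation coefficients\<close>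

text \<open>
  The contribution of row \<open>r + 1\<close> when rows \<open>r\<close> and \<open>r + 1\<close> of the subpartition have lengths \<open>d\<close> and
  \<open>e\<close>: the excited diagram contains the \<open>e\<close> fixed cells of row \<open>r + 1\<close> and the cells shifted from
  row \<open>r\<close>, which start in column \<open>d + 2\<close>.
\<close>

definition row_weight :: "nat \<Rightarrow> nat \<Rightarrow> nat \<Rightarrow> nat" where
  "row_weight r d e = (\<Prod>j\<in>{1..e} \<union> {d + 2..lam (Suc r)}. hook_length lam (Suc r, j))"

definition row_hooks :: "nat \<Rightarrow> nat" where
  "row_hooks r = (\<Prod>j=1..lam (Suc r). hook_length lam (Suc r, j))"

text \<open>
  Subpartitions cut off above row \<open>r\<close>. Row \<open>r\<close> enters only through its length \<open>d\<close>, which bounds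
  the rows below it; it is not itself required to fit into \<open>mu\<close>.
\<close>

definition tails :: "nat \<Rightarrow> nat \<Rightarrow> (nat \<Rightarrow> nat) set" where
  "tails r d = {kap. (\<forall>i<r. kap i = 0) \<and> kap r = d \<and>
     (\<forall>i\<ge>r. kap (Suc i) \<le> kap i \<and> kap (Suc i) \<le> mu (Suc i))}"

definition tail_sum :: "nat \<Rightarrow> nat \<Rightarrow> nat" where
  "tail_sum r d = (\<Sum>kap\<in>tails r d. \<Prod>i=r..<N. row_weight i (kap i) (kap (Suc i)))"

text \<open>
  The index \<open>i\<close> runs over the row above: row \<open>i + 1\<close> of the excited diagram is described by rows \<open>i\<close>
  and \<open>i + 1\<close> of \<open>kap\<close>.
\<close>

lemma excite_image_minus_first_row:
  assumes "kap \<in> subpartitions"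
  shows "remove_first_row (excite kap ` diagram mu)
       = (\<lambda>(i, j). (Suc i, j)) ` (SIGMA i:{1..<N}. {1..kap (Suc i)} \<union> {kap i + 2..lam (Suc i)})"
    (is "?L = ?R")
proof
  show "?L \<subseteq> ?R"
  proof
    fix x assume "x \<in> ?L"
    then obtain i j where ij: "(i, j) \<in> diagram mu" "x = excite kap (i, j)" "fst x \<noteq> 1"
      unfolding mem_remove_first_row by (metis imageE prod.collapse)
    have "1 \<le> i" "1 \<le> j" "j \<le> mu i" "i < N"
      using ij(1) row_less by (auto simp: diagram_def)
    show "x \<in> ?R"
    proof (cases "j \<le> kap i")
      case True
      with ij(2,3) have x: "x = (i, j)" "i \<noteq> 1"
        by (auto simp: excite_def)
      with \<open>1 \<le> i\<close> obtain i' where "i = Suc i'" "1 \<le> i'"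
        by (cases i) auto
      with x True \<open>1 \<le> j\<close> \<open>i < N\<close> show ?thesis
        by (intro image_eqI[of _ _ "(i', j)"]) auto
    next
      case False
      with ij(2) have "x = (Suc i, Suc j)"
        by (auto simp: excite_def)
      moreover have "Suc j \<le> lam (Suc i)"
        using mu_eq[OF \<open>1 \<le> i\<close>] \<open>1 \<le> j\<close> \<open>j \<le> mu i\<close> by simp
      ultimately show ?thesis
        using False \<open>1 \<le> i\<close> \<open>i < N\<close> by (intro image_eqI[of _ _ "(i, Suc j)"]) auto
    qed
  qed
  show "?R \<subseteq> ?L"
  proof
    fix x assume "x \<in> ?R"
    then obtain i j where x: "x = (Suc i, j)" "1 \<le> i"
      and "j \<in> {1..kap (Suc i)} \<union> {kap i + 2..lam (Suc i)}"
      by auto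
    then consider "1 \<le> j" "j \<le> kap (Suc i)" | "kap i + 2 \<le> j" "j \<le> lam (Suc i)"
      by auto
    then show "x \<in> ?L"
    proof cases
      case 1
      then have "(Suc i, j) \<in> diagram mu" "x = excite kap (Suc i, j)"
        using assms x by (auto simp: diagram_def subpartitions_def excite_def intro: le_trans)
      then show ?thesis
        using x by (simp add: mem_remove_first_row)
    next
      case 2
      then obtain j' where "j = Suc j'" "1 \<le> j'"
        by (cases j) auto
      then have "(i, j') \<in> diagram mu" "x = excite kap (i, j')"
        using 2 x mu_eq[of i] by (auto simp: diagram_def excite_def)
      then have "x \<in> excite kap ` diagram mu"
        by blast
      then show ?thesis
        using x by (simp add: mem_remove_first_row)
    qed
  qed
qed

lemma excite_image_hook_product:
  assumes "kap \<in> subpartitions"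
  shows "(\<Prod>c\<in>remove_first_row (excite kap ` diagram mu). hook_length lam c)
       = (\<Prod>i=1..<N. row_weight i (kap i) (kap (Suc i)))"
proof -
  have inj: "inj_on (\<lambda>(i, j). (Suc i, j)) A" for A :: "(nat \<times> nat) set"
    by (auto simp: inj_on_def)
  show ?thesis
    unfolding excite_image_minus_first_row[OF assms] row_weight_def
    by (subst prod.reindex[OF inj], subst prod.Sigma)
      (auto intro!: prod.cong)
qed

text \<open>
  Shifted cells leave the first row and none enter it.
\<close>

lemma excite_image_first_row:
  assumes "kap \<in> subpartitions"
  shows "card (excite kap ` diagram mu - remove_first_row (excite kap ` diagram mu)) = kap 1"
proof -
  have "excite kap ` diagram mu - remove_first_row (excite kap ` diagram mu) = Pair 1 ` {1..kap 1}"
    (is "?L = ?R")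
  proof
    show "?L \<subseteq> ?R"
    proof
      fix x assume "x \<in> ?L"
      then obtain i j where "(i, j) \<in> diagram mu" "x = excite kap (i, j)" "fst x = 1"
        unfolding mem_remove_first_row Diff_iff by (metis imageE prod.collapse)
      then show "x \<in> ?R"
        by (auto simp: excite_def diagram_def split: if_splits)
    qed
    have "(1, j) \<in> excite kap ` diagram mu" if "1 \<le> j" "j \<le> kap 1" for j
    proof
      show "(1, j) = excite kap (1, j)"
        using that by (simp add: excite_def)
      show "(1, j) \<in> diagram mu"
        using that assms by (force simp: diagram_def subpartitions_def)
    qed
    then show "?R \<subseteq> ?L"
      by (auto simp: mem_remove_first_row)
  qed
  then show ?thesis
    by (simp add: card_image inj_on_def)
qed

lemma tails_1_eq: "d \<le> mu 1 \<Longrightarrow> tails 1 d = {kap \<in> subpartitions. kap 1 = d}"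
proof -
  assume "d \<le> mu 1"
  then have "kap i \<le> mu i" if "kap \<in> tails 1 d" "1 \<le> i" for kap i
    using that by (cases i; cases "i = 1") (auto simp: tails_def)
  then show ?thesis
    by (auto simp: tails_def subpartitions_def)
qed

lemma excitation_coeff_eq_tail_sum:
  assumes "k \<le> mu 1"
  shows "excitation_coeff lam mu k = tail_sum 1 (mu 1 - k)"
proof -
  let ?E = "\<lambda>kap. excite kap ` diagram mu"
  have tails: "tails 1 (mu 1 - k) = {kap \<in> subpartitions. kap 1 + k = mu 1}"
    using assms by (subst tails_1_eq) auto
  have "{D \<in> excited_diagrams lam mu. card (D - remove_first_row D) + k = mu 1}
      = ?E ` tails 1 (mu 1 - k)"
    unfolding tails excited_diagrams_eq using excite_image_first_row by auto
  moreover have "inj_on ?E (tails 1 (mu 1 - k))"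
    unfolding tails by (rule inj_on_subset[OF inj_on_excite_image]) auto
  ultimately have "excitation_coeff lam mu k
      = (\<Sum>kap\<in>tails 1 (mu 1 - k). \<Prod>c\<in>remove_first_row (?E kap). hook_length lam c)"
    unfolding excitation_coeff_def by (simp only: sum.reindex o_def)
  also have "\<dots> = tail_sum 1 (mu 1 - k)"
    unfolding tail_sum_def
  proof (rule sum.cong[OF refl])
    fix kap assume "kap \<in> tails 1 (mu 1 - k)"
    then have "kap \<in> subpartitions"
      unfolding tails by simp
    then show "(\<Prod>c\<in>remove_first_row (?E kap). hook_length lam c)
        = (\<Prod>i=1..<N. row_weight i (kap i) (kap (Suc i)))"
      by (rule excite_image_hook_product)
  qed
  finally show ?thesis .
qed

lemma finite_tails: "finite (tails r d)"
proof -
  have bound: "kap i \<le> d" if "kap \<in> tails r d" for kap i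
  proof (cases "i < r")
    case False
    then have "r \<le> i" by simp
    then show ?thesis
      by (induction i rule: dec_induct) (use that in \<open>auto simp: tails_def intro: le_trans\<close>)
  qed (use that in \<open>simp add: tails_def\<close>)
  have zero: "kap i = 0" if "kap \<in> tails r d" "i > N + r" for kap i
  proof -
    obtain n where "i = Suc n" "r \<le> n" using \<open>i > N + r\<close> by (cases i) auto
    then have "kap i \<le> mu i" using that(1) by (auto simp: tails_def)
    also have "mu i = 0" using \<open>i > N + r\<close> by (simp add: mu_eq lam_eq_0)
    finally show ?thesis by simp
  qed
  have "tails r d \<subseteq> {kap. \<forall>i. (i \<in> {..N + r} \<longrightarrow> kap i \<in> {..d}) \<and> (i \<notin> {..N + r} \<longrightarrow> kap i = 0)}"
    using bound zero by auto
  then show ?thesis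
    by (rule finite_subset) (rule finite_set_of_finite_funs; simp)
qed

lemma tail_sum_rec:
  assumes "r < N"
  shows "tail_sum r d = (\<Sum>e\<le>min d (mu (Suc r)). row_weight r d e * tail_sum (Suc r) e)"
proof -
  let ?I = "{..min d (mu (Suc r))}" and ?f = "\<lambda>(e, kap). kap(r := d)"
  let ?w = "\<lambda>kap i. row_weight i (kap i) (kap (Suc i))"
  have "tail_sum r d = (\<Sum>(e, kap)\<in>(SIGMA e:?I. tails (Suc r) e). row_weight r d e * (\<Prod>i=Suc r..<N. ?w kap i))"
    unfolding tail_sum_def
  proof (rule sum.reindex_bij_witness[of _ "?f" "\<lambda>kap. (kap (Suc r), kap(r := 0))"])
    fix kap assume kap: "kap \<in> tails r d"
    show "?f (kap (Suc r), kap(r := 0)) = kap"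
      using kap by (auto simp: tails_def)
    show "(kap (Suc r), kap(r := 0)) \<in> (SIGMA e:?I. tails (Suc r) e)"
      using kap by (auto simp: tails_def less_Suc_eq)
    have "(\<Prod>i=r..<N. ?w kap i) = ?w kap r * (\<Prod>i=Suc r..<N. ?w kap i)"
      using assms by (rule prod.atLeast_Suc_lessThan)
    then show "(case (kap (Suc r), kap(r := 0)) of (e, kap) \<Rightarrow> row_weight r d e * (\<Prod>i=Suc r..<N. ?w kap i))
        = (\<Prod>i=r..<N. ?w kap i)"
      using kap by (auto simp: tails_def intro!: prod.cong)
  next
    fix x assume "x \<in> (SIGMA e:?I. tails (Suc r) e)"
    then obtain kap where x: "x = (kap (Suc r), kap)" "kap \<in> tails (Suc r) (kap (Suc r))"
      "kap (Suc r) \<le> d" "kap (Suc r) \<le> mu (Suc r)"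
      by (auto simp: tails_def)
    then show "(?f x (Suc r), (?f x)(r := 0)) = x"
      by (simp add: tails_def fun_upd_idem)
    have "(kap(r := d)) (Suc i) \<le> (kap(r := d)) i \<and> (kap(r := d)) (Suc i) \<le> mu (Suc i)"
      if "r \<le> i" for i
      using x that by (cases "i = r") (auto simp: tails_def)
    then show "?f x \<in> tails r d"
      using x by (auto simp: tails_def)
  qed
  also have "\<dots> = (\<Sum>e\<in>?I. \<Sum>kap\<in>tails (Suc r) e. row_weight r d e * (\<Prod>i=Suc r..<N. ?w kap i))"
    by (rule sum.Sigma[symmetric]) (auto simp: finite_tails)
  finally show ?thesis
    by (simp add: tail_sum_def sum_distrib_left)
qed

text \<open>
  The next two identities restore one hook length missing from a row. In terms of paths they remove
  the last cell of the path in its row: in the first one a cell to its left remains, in the second one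
  it was the only cell of the row.
\<close>

lemma row_weight_step:
  assumes "e \<le> b" "b + 2 \<le> lam (Suc r)"
  shows "hook_length lam (Suc r, b + 2) * row_weight r (Suc b) e = row_weight r b e"
proof -
  have "{1..e} \<union> {b + 2..lam (Suc r)} = insert (b + 2) ({1..e} \<union> {Suc b + 2..lam (Suc r)})"
    using assms by auto
  then show ?thesis
    using assms unfolding row_weight_def by simp
qed

lemma row_weight_diagonal:
  assumes "d < lam (Suc r)"
  shows "hook_length lam (Suc r, Suc d) * row_weight r d d = row_hooks r"
proof -
  have "{1..lam (Suc r)} = insert (Suc d) ({1..d} \<union> {d + 2..lam (Suc r)})"
    using assms by auto
  then show ?thesis
    unfolding row_weight_def row_hooks_def by simp
qed

text \<open>
  In the sum over the length \<open>e\<close> of the next row, the terms with \<open>e < d\<close> are paths that reach the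
  cell \<open>(r + 1, d + 1)\<close> from the left, and the term \<open>e = d\<close> collects those that reach it from below.
\<close>

lemma hook_times_tail_sum:
  assumes "r < N" "d < lam (Suc r)"
  shows "hook_length lam (Suc r, Suc d) * tail_sum r d
       = (case d of 0 \<Rightarrow> 0 | Suc b \<Rightarrow> tail_sum r b)
         + (if d \<le> mu (Suc r) then row_hooks r * tail_sum (Suc r) d else 0)"
proof -
  let ?h = "hook_length lam (Suc r, Suc d)" and ?m = "mu (Suc r)"
  let ?t = "\<lambda>e. row_weight r d e * tail_sum (Suc r) e"
  have range_split: "{..min d ?m} = {e. e < d \<and> e \<le> ?m} \<union> (if d \<le> ?m then {d} else {})"
    by auto
  have "tail_sum r d = (\<Sum>e\<le>min d ?m. ?t e)"
    by (rule tail_sum_rec[OF assms(1)])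
  also have "\<dots> = (\<Sum>e | e < d \<and> e \<le> ?m. ?t e) + (if d \<le> ?m then ?t d else 0)"
    unfolding range_split by (subst sum.union_disjoint) auto
  finally have "?h * tail_sum r d = (\<Sum>e | e < d \<and> e \<le> ?m. ?h * ?t e) + (if d \<le> ?m then ?h * ?t d else 0)"
    by (simp add: distrib_left sum_distrib_left)
  moreover have "?h * ?t d = row_hooks r * tail_sum (Suc r) d"
    using row_weight_diagonal[OF assms(2)] by (simp add: mult.assoc[symmetric])
  moreover have "(\<Sum>e | e < d \<and> e \<le> ?m. ?h * ?t e) = (case d of 0 \<Rightarrow> 0 | Suc b \<Rightarrow> tail_sum r b)"
  proof (cases d)
    case (Suc b)
    then have "{e. e < d \<and> e \<le> ?m} = {..min b ?m}"
      by auto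
    moreover have "?h * ?t e = row_weight r b e * tail_sum (Suc r) e" if "e \<le> b" for e
      using row_weight_step[OF that, of r] assms(2) Suc by (simp add: mult.assoc[symmetric])
    ultimately show ?thesis
      using Suc by (auto simp: tail_sum_rec[OF assms(1), of b] intro!: sum.cong)
  qed simp
  ultimately show ?thesis by simp
qed

section \<open>The inequality\<close>

text \<open>
  The outer induction goes from the bottom row upwards, the inner one from left to right. Below,
  \<open>a\<close> is the hook length of \<open>(r + 1, b + 2)\<close> without its leg, that is, its arm and the cell itself.
\<close>

lemma tail_sum_le:
  assumes "1 \<le> r" "Suc (Suc b) \<le> lam (Suc r)"
  shows "tail_sum r b \<le> (lam (Suc r) - Suc b) * tail_sum r (Suc b)"
  using assms
proof (induction "N - r" arbitrary: r b rule: less_induct)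
  case less
  note rows = less.hyps and r = less.prems(1)
  have "r < N"
    using less.prems lam_eq_0[of "Suc r"] by (cases "Suc r \<le> N") auto
  show ?case
    using less.prems(2)
  proof (induction b rule: less_induct)
    case (less b)
    let ?l = "lam (Suc r)" and ?P = "row_hooks r"
    let ?S = "tail_sum r b" and ?S' = "tail_sum r (Suc b)" and ?T' = "tail_sum (Suc r) (Suc b)"
    define a where "a = ?l - Suc b"
    have l: "?l = Suc (a + b)" and "1 \<le> a" using less.prems by (auto simp: a_def)
    have hook': "hook_length lam (Suc r, Suc (Suc b)) = a + leg (Suc r) (Suc (Suc b))"
      using hook_length_eq[of "Suc r" "Suc b"] less.prems by (simp add: a_def)
    have hook: "hook_length lam (Suc r, Suc b) = a + 1 + leg (Suc r) (Suc b)"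
      using hook_length_eq[of "Suc r" b] less.prems by (simp add: a_def)
    have rec': "(a + leg (Suc r) (Suc (Suc b))) * ?S' = ?S + (if Suc b \<le> mu (Suc r) then ?P * ?T' else 0)"
      using hook_times_tail_sum[OF \<open>r < N\<close>, of "Suc b"] less.prems by (simp add: hook')
    \<comment> \<open>By the recursion for \<open>?S'\<close>, this is the claim multiplied by the hook length.\<close>
    have key: "leg (Suc r) (Suc (Suc b)) * ?S \<le> a * (if Suc b \<le> mu (Suc r) then ?P * ?T' else 0)"
    proof (cases "Suc b \<le> mu (Suc r)")
      case False
      \<comment> \<open>No cell lies below \<open>(r + 1, b + 2)\<close>.\<close>
      then have "leg (Suc r) (Suc (Suc b)) = 0"
        using r by (intro leg_eq_0) (simp add: mu_eq)
      then show ?thesis by simp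
    next
      case True
      then have l': "Suc (Suc b) \<le> lam (Suc (Suc r))"
        using r by (simp add: mu_eq)
      have "(a + 1 + leg (Suc r) (Suc b)) * ?S
          = (case b of 0 \<Rightarrow> 0 | Suc b' \<Rightarrow> tail_sum r b') + ?P * tail_sum (Suc r) b"
        using hook_times_tail_sum[OF \<open>r < N\<close>, of b] less.prems True by (simp add: hook)
      also have "(case b of 0 \<Rightarrow> 0 | Suc b' \<Rightarrow> tail_sum r b') \<le> (a + 1) * ?S"
        using less.IH[of "b - 1"] less.prems l by (auto split: nat.split)
      also have "tail_sum (Suc r) b \<le> (lam (Suc (Suc r)) - Suc b) * ?T'"
        using rows[of "Suc r" b] \<open>r < N\<close> l' by simp
      also have "lam (Suc (Suc r)) - Suc b \<le> a"
        using antimono[of "Suc r" "Suc (Suc r)"] by (simp add: a_def)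
      finally have "leg (Suc r) (Suc b) * ?S \<le> ?P * (a * ?T')"
        by (simp add: algebra_simps)
      moreover have "leg (Suc r) (Suc (Suc b)) * ?S \<le> leg (Suc r) (Suc b) * ?S"
        by (intro mult_right_mono leg_antimono) auto
      ultimately have "leg (Suc r) (Suc (Suc b)) * ?S \<le> ?P * (a * ?T')"
        by (rule le_trans[rotated])
      then show ?thesis
        using True by (simp only: if_True mult.left_commute)
    qed
    have "(a + leg (Suc r) (Suc (Suc b))) * ?S
        \<le> a * ((a + leg (Suc r) (Suc (Suc b))) * ?S')"
      using key unfolding rec' by (simp add: algebra_simps)
    then have "(a + leg (Suc r) (Suc (Suc b))) * ?S \<le> (a + leg (Suc r) (Suc (Suc b))) * (a * ?S')"
      by (simp only: mult.left_commute)
    then show ?case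
      using \<open>1 \<le> a\<close> by (simp add: a_def[symmetric])
  qed
qed

lemma excitation_coeff_Suc_le:
  assumes "k < mu 1"
  shows "excitation_coeff lam mu (Suc k) \<le> Suc k * excitation_coeff lam mu k"
proof -
  have "lam 2 = Suc (mu 1)"
    using assms by (simp add: mu_eq numeral_2_eq_2)
  then show ?thesis
    using tail_sum_le[of 1 "mu 1 - Suc k"] assms
    by (simp add: excitation_coeff_eq_tail_sum numeral_2_eq_2 Suc_diff_Suc)
qed

end

section \<open>Ribbons\<close>

text \<open>
  Connectedness bounds \<open>lam (Suc i)\<close> from below. If it exceeded \<open>mu i + 1\<close>, the columns
  \<open>mu i + 1\<close> and \<open>mu i + 2\<close> of rows \<open>i\<close> and \<open>i + 1\<close> would form a forbidden square. When \<open>mu i = 0\<close>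
  the next row may be empty, and the truncated difference is still right.
\<close>

lemma ribbon_inner_shape:
  assumes "ribbon lam mu" "skew_shape lam mu" "1 \<le> i"
  shows "mu i = lam (Suc i) - 1"
proof -
  have "lam (Suc i) \<le> mu i + 1"
  proof (rule ccontr)
    assume "\<not> lam (Suc i) \<le> mu i + 1"
    moreover have "lam (Suc i) \<le> lam i" "mu (Suc i) \<le> mu i"
      using assms by (auto simp: skew_shape_def is_partition_def)
    ultimately have "{(i, mu i + 1), (i, Suc (mu i + 1)), (Suc i, mu i + 1), (Suc i, Suc (mu i + 1))}
        \<subseteq> skew_diagram lam mu"
      using assms(3) by (auto simp: skew_diagram_def diagram_def)
    with assms(1) show False
      unfolding ribbon_def by blast
  qed
  moreover have "mu i \<noteq> 0 \<Longrightarrow> mu i < lam (Suc i)"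
    using assms by (auto simp: ribbon_def skew_connected_def)
  ultimately show ?thesis by linarith
qed

theorem proposition2p5:
  fixes lam mu :: "nat \<Rightarrow> nat" and s :: nat and C :: "nat \<Rightarrow> nat"
  assumes "skew_shape lam mu"
    and "lam 1 = lam 2"
    and "ribbon lam mu"
    and "s = mu 1"
    and "\<And>k. k \<le> s \<Longrightarrow> C k = excitation_coeff lam mu k"
  shows "\<forall>k<s. real (C k) / fact k \<ge> real (C (Suc k)) / fact (Suc k)"
proof (intro allI impI)
  fix k assume k: "k < s"
  obtain N where N: "\<forall>i\<ge>N. lam i = 0"
    using assms(1) by (auto simp: skew_shape_def is_partition_def)
  interpret border_strip lam mu N
    using assms(1) N ribbon_inner_shape[OF assms(3,1)]
    by unfold_locales (auto simp: skew_shape_def)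
  have "C (Suc k) \<le> Suc k * C k"
    using excitation_coeff_Suc_le[of k] k assms(4,5) by simp
  then have "real (C (Suc k)) \<le> real (Suc k) * real (C k)"
    by (metis of_nat_le_iff of_nat_mult)
  then have "real (C (Suc k)) / fact (Suc k) \<le> real (Suc k) * real (C k) / fact (Suc k)"
    by (rule divide_right_mono) simp
  also have "\<dots> = real (C k) / fact k"
    by (simp del: of_nat_Suc)
  finally show "real (C (Suc k)) / fact (Suc k) \<le> real (C k) / fact k" .
qed

end
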